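(* Let $L$ be a completely distributive lattice, $G$ a group, and $\mu$ an $L$-subgroup of $G$. Let $\eta$ be a contranormal $L$-subgroup of $\mu$. Then $\eta$ is a normal $L$-subgroup of $\mu$ if and only if $\eta=\mu$. Moreover, if $\eta$ is a proper $L$-subgroup of $\mu$, then $\eta$ is not a subnormal $L$-subgroup of $\mu$. Hence either $\eta$ is a subnormal $L$-subgroup of $\mu$ with defect $0$, or $\eta$ is not a subnormal $L$-subgroup of $\mu$.
   Context: $L$ is a completely distributive (in particular complete) lattice with greatest element $1$ and least element $0$; $G$ is a group. An $L$-subset of $G$ is a function $G\to L$; $\eta\subseteq\nu$ means $\eta(x)\le\nu(x)$ for all $x\in G$. An $L$-subgroup of $G$ is an $L$-subset $\mu$ with $\mu(xy)\ge\mu(x)\wedge\mu(y)$ and $\mu(x^{-1})=\mu(x)$ for all $x,y\in G$. An $L$-subgroup of $\mu$ is an $L$-subgroup $\eta$ of $G$ with $\eta\subseteq\mu$. It is proper if $\eta$ is non-constant and $\eta\ne\mu$. It is a normal $L$-subgroup of $\mu$ (written $\eta\triangleleft\mu$) if $\eta(yxy^{-1})\ge\eta(x)\wedge\mu(y)$ for all $x,y\in G$. For $a\in L$, $z\in G$, the $L$-point $a_z$ is the $L$-subset with value $a$ at $z$ and $0$ elsewhere; $a_z\in\mu$ means $\mu(z)\ge a$. For $\eta$ an $L$-subgroup of $\mu$ and $a_z\in\mu$, the conjugate $\eta^{a_z}$ is the $L$-subset $\eta^{a_z}(x)=a\wedge\eta(zxz^{-1})$, $x\in G$. An $L$-subgroup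 $\eta$ of $\mu$ is a contranormal $L$-subgroup of $\mu$ if there is no $L$-subgroup $\theta$ of $\mu$ with $\theta\neq\mu$ such that $\eta^{a_z}\subseteq\theta$ for every $L$-point $a_z\in\mu$. For $\eta$ an $L$-subgroup of $\mu$, let $\mu\eta\mu^{-1}(x)=\bigvee_{x=zyz^{-1}}\{\eta(y)\wedge\mu(z)\}$ for $x\in G$. The normal closure $\eta^\mu$ of $\eta$ in $\mu$ is the $L$-subgroup of $\mu$ generated by $\mu\eta\mu^{-1}$, i.e. the pointwise infimum of all $L$-subgroups of $\mu$ containing $\mu\eta\mu^{-1}$; it is the smallest normal $L$-subgroup of $\mu$ containing $\eta$. The normal closure series of $\eta$ in $\mu$ is defined by $\eta_0=\mu$ and $\eta_i=\eta^{\eta_{i-1}}$ (the normal closure of $\eta$ in $\eta_{i-1}$) for $i\ge1$. If there is a non-negative integer $m$ with $\eta=\eta_m\triangleleft\eta_{m-1}\triangleleft\cdots\triangleleft\eta_0=\mu$, then $\eta$ is a subnormal $L$-subgroup of $\mu$ with defect $m$ (the least such $m$); so $m=0$ if $\eta=\mu$, and $m=1$ if $\eta\triangleleft\mu$ and $\eta\ne\mu$. *)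

theory Defs
  imports "HOL-Algebra.Group" "HOL-Library.FuncSet"
begin

text \<open>
  The lattice \<open>L\<close> is a type of class \<^class>\<open>complete_distrib_lattice\<close>, whose axiom is full complete
  distributivity (arbitrary meets of arbitrary joins). An \<open>L\<close>-subset of \<open>G\<close> is a function
  \<open>carrier G \<rightarrow> L\<close>; it is represented by an extensional function, so that HOL equality of
  \<open>L\<close>-subsets is equality of functions on \<open>carrier G\<close>.
\<close>

definition L_subsets :: "('g, 'm) monoid_scheme \<Rightarrow> ('g \<Rightarrow> 'l::complete_distrib_lattice) set" where
  "L_subsets G = carrier G \<rightarrow>\<^sub>E UNIV"

definition L_contained ::
    "('g, 'm) monoid_scheme \<Rightarrow> ('g \<Rightarrow> 'l::complete_distrib_lattice) \<Rightarrow> ('g \<Rightarrow> 'l) \<Rightarrow> bool" where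
  "L_contained G \<eta> \<nu> \<longleftrightarrow> (\<forall>x\<in>carrier G. \<eta> x \<le> \<nu> x)"

definition L_subgroup ::
    "('g, 'm) monoid_scheme \<Rightarrow> ('g \<Rightarrow> 'l::complete_distrib_lattice) \<Rightarrow> bool" where
  "L_subgroup G \<mu> \<longleftrightarrow> \<mu> \<in> L_subsets G \<and>
     (\<forall>x\<in>carrier G. \<forall>y\<in>carrier G. \<mu> (x \<otimes>\<^bsub>G\<^esub> y) \<ge> inf (\<mu> x) (\<mu> y)) \<and>
     (\<forall>x\<in>carrier G. \<mu> (inv\<^bsub>G\<^esub> x) = \<mu> x)"

text \<open>
  In all relative notions below the ambient \<open>L\<close>-subgroup \<open>\<mu>\<close> comes first: \<open>L_subgroup_of G \<mu> \<eta>\<close>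
  reads ``\<open>\<eta>\<close> is an \<open>L\<close>-subgroup of \<open>\<mu>\<close>''. That \<open>\<mu>\<close> is itself an \<open>L\<close>-subgroup of \<open>G\<close> is not
  part of these definitions.
\<close>

definition L_subgroup_of ::
    "('g, 'm) monoid_scheme \<Rightarrow> ('g \<Rightarrow> 'l::complete_distrib_lattice) \<Rightarrow> ('g \<Rightarrow> 'l) \<Rightarrow> bool" where
  "L_subgroup_of G \<mu> \<eta> \<longleftrightarrow> L_subgroup G \<eta> \<and> L_contained G \<eta> \<mu>"

definition proper_L_subgroup_of ::
    "('g, 'm) monoid_scheme \<Rightarrow> ('g \<Rightarrow> 'l::complete_distrib_lattice) \<Rightarrow> ('g \<Rightarrow> 'l) \<Rightarrow> bool" where
  "proper_L_subgroup_of G \<mu> \<eta> \<longleftrightarrow> L_subgroup_of G \<mu> \<eta> \<and>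
     \<not> (\<exists>c. \<forall>x\<in>carrier G. \<eta> x = c) \<and> \<eta> \<noteq> \<mu>"

definition normal_L_subgroup_of ::
    "('g, 'm) monoid_scheme \<Rightarrow> ('g \<Rightarrow> 'l::complete_distrib_lattice) \<Rightarrow> ('g \<Rightarrow> 'l) \<Rightarrow> bool" where
  "normal_L_subgroup_of G \<mu> \<eta> \<longleftrightarrow> L_subgroup_of G \<mu> \<eta> \<and>
     (\<forall>x\<in>carrier G. \<forall>y\<in>carrier G. \<eta> (y \<otimes>\<^bsub>G\<^esub> x \<otimes>\<^bsub>G\<^esub> inv\<^bsub>G\<^esub> y) \<ge> inf (\<eta> x) (\<mu> y))"

text \<open>
  An \<open>L\<close>-point \<open>a\<^sub>z\<close> is handled through its value \<open>a\<close> and its support \<open>z\<close>, since the conjugate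
  \<open>\<eta>\<close> by \<open>a\<^sub>z\<close> is defined from \<open>a\<close> and \<open>z\<close>; the value \<open>a = 0\<close> is allowed.
\<close>

definition L_point_in ::
    "('g, 'm) monoid_scheme \<Rightarrow> ('g \<Rightarrow> 'l::complete_distrib_lattice) \<Rightarrow> 'l \<Rightarrow> 'g \<Rightarrow> bool" where
  "L_point_in G \<mu> a z \<longleftrightarrow> z \<in> carrier G \<and> \<mu> z \<ge> a"

definition L_conjugate ::
    "('g, 'm) monoid_scheme \<Rightarrow> ('g \<Rightarrow> 'l::complete_distrib_lattice) \<Rightarrow> 'l \<Rightarrow> 'g \<Rightarrow> 'g \<Rightarrow> 'l" where
  "L_conjugate G \<eta> a z = (\<lambda>x\<in>carrier G. inf a (\<eta> (z \<otimes>\<^bsub>G\<^esub> x \<otimes>\<^bsub>G\<^esub> inv\<^bsub>G\<^esub> z)))"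

definition contranormal_L_subgroup_of ::
    "('g, 'm) monoid_scheme \<Rightarrow> ('g \<Rightarrow> 'l::complete_distrib_lattice) \<Rightarrow> ('g \<Rightarrow> 'l) \<Rightarrow> bool" where
  "contranormal_L_subgroup_of G \<mu> \<eta> \<longleftrightarrow> L_subgroup_of G \<mu> \<eta> \<and>
     \<not> (\<exists>\<theta>. L_subgroup_of G \<mu> \<theta> \<and> \<theta> \<noteq> \<mu> \<and>
          (\<forall>a z. L_point_in G \<mu> a z \<longrightarrow> L_contained G (L_conjugate G \<eta> a z) \<theta>))"

text \<open>The \<open>L\<close>-subset \<open>\<mu>\<eta>\<mu>\<^sup>-\<^sup>1\<close>.\<close>

definition L_conjugates ::
    "('g, 'm) monoid_scheme \<Rightarrow> ('g \<Rightarrow> 'l::complete_distrib_lattice) \<Rightarrow> ('g \<Rightarrow> 'l) \<Rightarrow> 'g \<Rightarrow> 'l" where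
  "L_conjugates G \<mu> \<eta> = (\<lambda>x\<in>carrier G.
     SUP (y, z) \<in> {(y, z). y \<in> carrier G \<and> z \<in> carrier G \<and> x = z \<otimes>\<^bsub>G\<^esub> y \<otimes>\<^bsub>G\<^esub> inv\<^bsub>G\<^esub> z}.
       inf (\<eta> y) (\<mu> z))"

definition L_normal_closure ::
    "('g, 'm) monoid_scheme \<Rightarrow> ('g \<Rightarrow> 'l::complete_distrib_lattice) \<Rightarrow> ('g \<Rightarrow> 'l) \<Rightarrow> 'g \<Rightarrow> 'l" where
  "L_normal_closure G \<mu> \<eta> = (\<lambda>x\<in>carrier G.
     INF \<theta> \<in> {\<theta>. L_subgroup_of G \<mu> \<theta> \<and> L_contained G (L_conjugates G \<mu> \<eta>) \<theta>}. \<theta> x)"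

primrec L_normal_closure_series ::
    "('g, 'm) monoid_scheme \<Rightarrow> ('g \<Rightarrow> 'l::complete_distrib_lattice) \<Rightarrow> ('g \<Rightarrow> 'l) \<Rightarrow> nat \<Rightarrow> 'g \<Rightarrow> 'l"
where
  "L_normal_closure_series G \<mu> \<eta> 0 = \<mu>"
| "L_normal_closure_series G \<mu> \<eta> (Suc i) = L_normal_closure G (L_normal_closure_series G \<mu> \<eta> i) \<eta>"

definition reached_by_normal_series ::
    "('g, 'm) monoid_scheme \<Rightarrow> ('g \<Rightarrow> 'l::complete_distrib_lattice) \<Rightarrow> ('g \<Rightarrow> 'l) \<Rightarrow> nat \<Rightarrow> bool" where
  "reached_by_normal_series G \<mu> \<eta> m \<longleftrightarrow> \<eta> = L_normal_closure_series G \<mu> \<eta> m \<and>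
     (\<forall>i<m. normal_L_subgroup_of G (L_normal_closure_series G \<mu> \<eta> i)
              (L_normal_closure_series G \<mu> \<eta> (Suc i)))"

definition subnormal_L_subgroup_of ::
    "('g, 'm) monoid_scheme \<Rightarrow> ('g \<Rightarrow> 'l::complete_distrib_lattice) \<Rightarrow> ('g \<Rightarrow> 'l) \<Rightarrow> bool" where
  "subnormal_L_subgroup_of G \<mu> \<eta> \<longleftrightarrow>
     L_subgroup_of G \<mu> \<eta> \<and> (\<exists>m. reached_by_normal_series G \<mu> \<eta> m)"

text \<open>Meaningful only when \<open>\<eta>\<close> is a subnormal \<open>L\<close>-subgroup of \<open>\<mu>\<close>.\<close>

definition subnormal_defect ::
    "('g, 'm) monoid_scheme \<Rightarrow> ('g \<Rightarrow> 'l::complete_distrib_lattice) \<Rightarrow> ('g \<Rightarrow> 'l) \<Rightarrow> nat" where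
  "subnormal_defect G \<mu> \<eta> = (LEAST m. reached_by_normal_series G \<mu> \<eta> m)"

end

theory Submission
  imports Defs
begin

text \<open>
  Conjugating by \<open>a\<^sub>z\<close> sends \<open>x\<close> to \<open>zxz\<^sup>-\<^sup>1\<close>, so \<open>\<eta>\<close> conjugated by \<open>a\<^sub>z\<close> lies below \<open>\<mu>\<eta>\<mu>\<^sup>-\<^sup>1\<close> (use the
  decomposition of \<open>x\<close> with conjugating element \<open>z\<^sup>-\<^sup>1\<close>). Hence, if \<open>\<eta>\<close> is contranormal, the only
  \<open>L\<close>-subgroup of \<open>\<mu>\<close> containing \<open>\<mu>\<eta>\<mu>\<^sup>-\<^sup>1\<close> is \<open>\<mu>\<close>. A normal \<open>\<eta>\<close> is such an \<open>L\<close>-subgroup, and in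
  general the normal closure of \<open>\<eta>\<close> is \<open>\<mu>\<close>, so the normal closure series is constant.
\<close>

lemma L_subgroup_of_refl: "L_subgroup G \<mu> \<Longrightarrow> L_subgroup_of G \<mu> \<mu>"
  by (simp add: L_subgroup_of_def L_contained_def)

lemma (in group) inv_conjugate_cancel:
  assumes "x \<in> carrier G" "z \<in> carrier G"
  shows "inv z \<otimes> (z \<otimes> x \<otimes> inv z) \<otimes> z = x"
proof -
  have "inv z \<otimes> (z \<otimes> x \<otimes> inv z) = x \<otimes> inv z"
    using assms by (simp add: m_assoc inv_solve_left')
  then show ?thesis
    using assms by (simp add: m_assoc)
qed

lemma (in group) normal_L_subgroup_of_refl:
  assumes "L_subgroup G \<mu>"
  shows "normal_L_subgroup_of G \<mu> \<mu>"
  unfolding normal_L_subgroup_of_def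
proof (intro conjI ballI)
  show "L_subgroup_of G \<mu> \<mu>"
    using assms by (rule L_subgroup_of_refl)
next
  fix x y assume [simp]: "x \<in> carrier G" "y \<in> carrier G"
  have mult: "inf (\<mu> u) (\<mu> v) \<le> \<mu> (u \<otimes> v)" if "u \<in> carrier G" "v \<in> carrier G" for u v
    using assms that by (simp add: L_subgroup_def)
  \<comment> \<open>Since \<open>\<mu> (inv y) = \<mu> y\<close>, the meet can list
    \<open>\<mu> y\<close> twice, once for each outer factor of the conjugate.\<close>
  have "inf (\<mu> x) (\<mu> y) \<le> inf (inf (\<mu> y) (\<mu> x)) (\<mu> (inv y))"
    using assms by (simp add: L_subgroup_def)
  also have "\<dots> \<le> inf (\<mu> (y \<otimes> x)) (\<mu> (inv y))"
    by (intro inf_mono mult order_refl) simp_all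
  also have "\<dots> \<le> \<mu> (y \<otimes> x \<otimes> inv y)"
    by (intro mult) simp_all
  finally show "inf (\<mu> x) (\<mu> y) \<le> \<mu> (y \<otimes> x \<otimes> inv y)" .
qed

text \<open>Normality of \<open>\<nu>\<close> bounds every term of the supremum. Keeping
  \<open>\<eta>\<close> and \<open>\<nu>\<close> apart covers two uses:
  \<open>\<nu> = \<eta>\<close> for a normal \<open>\<eta>\<close>, and \<open>\<nu> = \<mu>\<close>
  for the normal closure.\<close>

lemma L_conjugates_contained_normal:
  assumes "normal_L_subgroup_of G \<mu> \<nu>" "L_contained G \<eta> \<nu>"
  shows "L_contained G (L_conjugates G \<mu> \<eta>) \<nu>"
proof -
  have "inf (\<eta> y) (\<mu> z) \<le> \<nu> (z \<otimes>\<^bsub>G\<^esub> y \<otimes>\<^bsub>G\<^esub> inv\<^bsub>G\<^esub> z)"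
    if "y \<in> carrier G" "z \<in> carrier G" for y z
  proof -
    have "inf (\<eta> y) (\<mu> z) \<le> inf (\<nu> y) (\<mu> z)"
      using assms(2) that by (intro inf_mono) (auto simp: L_contained_def)
    also have "\<dots> \<le> \<nu> (z \<otimes>\<^bsub>G\<^esub> y \<otimes>\<^bsub>G\<^esub> inv\<^bsub>G\<^esub> z)"
      using assms(1) that by (simp add: normal_L_subgroup_of_def)
    finally show ?thesis .
  qed
  then show ?thesis
    by (auto simp: L_contained_def L_conjugates_def intro!: SUP_least)
qed

lemma (in group) L_conjugate_contained_L_conjugates:
  assumes "L_subgroup G \<mu>" "L_point_in G \<mu> a z"
  shows "L_contained G (L_conjugate G \<eta> a z) (L_conjugates G \<mu> \<eta>)"
  unfolding L_contained_def
proof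
  fix x assume x: "x \<in> carrier G"
  \<comment> \<open>The bound \<open>a \<le> \<mu> z\<close> passes to \<open>inv z\<close>, the
    conjugating element needed in \<open>L_conjugates\<close>, because \<open>\<mu>\<close> is
    invariant under inversion.\<close>
  have z: "z \<in> carrier G" and a: "a \<le> \<mu> (inv z)"
    using assms by (auto simp: L_point_in_def L_subgroup_def)
  have "L_conjugate G \<eta> a z x \<le> inf (\<eta> (z \<otimes> x \<otimes> inv z)) (\<mu> (inv z))"
    using x a by (simp add: L_conjugate_def le_infI1)
  also have "\<dots> \<le> L_conjugates G \<mu> \<eta> x"
    using x z unfolding L_conjugates_def
    by (auto simp: inv_conjugate_cancel intro!: SUP_upper2[of "(z \<otimes> x \<otimes> inv z, inv z)"])
  finally show "L_conjugate G \<eta> a z x \<le> L_conjugates G \<mu> \<eta> x" .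
qed

lemma (in group) contranormal_L_conjugates_contained_eq:
  assumes "L_subgroup G \<mu>" "contranormal_L_subgroup_of G \<mu> \<eta>"
    and "L_subgroup_of G \<mu> \<theta>" "L_contained G (L_conjugates G \<mu> \<eta>) \<theta>"
  shows "\<theta> = \<mu>"
proof -
  have "L_contained G (L_conjugate G \<eta> a z) \<theta>" if "L_point_in G \<mu> a z" for a z
    using L_conjugate_contained_L_conjugates[OF assms(1) that] assms(4)
    unfolding L_contained_def by (blast intro: order_trans)
  then show ?thesis
    using assms(2,3) unfolding contranormal_L_subgroup_of_def by blast
qed

lemma (in group) L_normal_closure_contranormal:
  assumes "L_subgroup G \<mu>" "contranormal_L_subgroup_of G \<mu> \<eta>"
  shows "L_normal_closure G \<mu> \<eta> = \<mu>"
proof -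
  have "L_contained G \<eta> \<mu>"
    using assms(2) by (simp add: contranormal_L_subgroup_of_def L_subgroup_of_def)
  then have "L_contained G (L_conjugates G \<mu> \<eta>) \<mu>"
    by (rule L_conjugates_contained_normal[OF normal_L_subgroup_of_refl[OF assms(1)]])
  \<comment> \<open>Contranormality leaves no candidate other than \<open>\<mu>\<close>, and
    \<open>\<mu>\<close> qualifies since it is normal in itself; the infimum thus runs over one
    element.\<close>
  then have "{\<theta>. L_subgroup_of G \<mu> \<theta> \<and> L_contained G (L_conjugates G \<mu> \<eta>) \<theta>} = {\<mu>}"
    using contranormal_L_conjugates_contained_eq[OF assms] L_subgroup_of_refl[OF assms(1)] by blast
  then have "L_normal_closure G \<mu> \<eta> = restrict \<mu> (carrier G)"
    by (simp add: L_normal_closure_def)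
  \<comment> \<open>As an L-subset, \<open>\<mu>\<close> is extensional, so restricting it to the
    carrier changes nothing.\<close>
  then show ?thesis
    using assms(1) by (simp add: L_subgroup_def L_subsets_def PiE_def extensional_restrict)
qed

lemma (in group) L_normal_closure_series_contranormal:
  assumes "L_subgroup G \<mu>" "contranormal_L_subgroup_of G \<mu> \<eta>"
  shows "L_normal_closure_series G \<mu> \<eta> i = \<mu>"
  by (induction i) (simp_all add: L_normal_closure_contranormal[OF assms])

theorem theorem4p4:
  fixes G :: "('g, 'm) monoid_scheme"
    and \<mu> \<eta> :: "'g \<Rightarrow> 'l::complete_distrib_lattice"
  assumes "group G"
    and "L_subgroup G \<mu>"
    and "contranormal_L_subgroup_of G \<mu> \<eta>"
  shows "(normal_L_subgroup_of G \<mu> \<eta> \<longleftrightarrow> \<eta> = \<mu>) \<and>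
    (proper_L_subgroup_of G \<mu> \<eta> \<longrightarrow> \<not> subnormal_L_subgroup_of G \<mu> \<eta>) \<and>
    ((subnormal_L_subgroup_of G \<mu> \<eta> \<and> subnormal_defect G \<mu> \<eta> = 0) \<or>
      \<not> subnormal_L_subgroup_of G \<mu> \<eta>)"
proof -
  interpret group G by fact
  have normal_eq: "\<eta> = \<mu>" if "normal_L_subgroup_of G \<mu> \<eta>"
    using that contranormal_L_conjugates_contained_eq[OF assms(2,3)]
      L_conjugates_contained_normal[OF that]
    by (simp add: normal_L_subgroup_of_def L_contained_def)
  have subnormal_eq: "\<eta> = \<mu>" if "subnormal_L_subgroup_of G \<mu> \<eta>"
    using that L_normal_closure_series_contranormal[OF assms(2,3)]
    by (auto simp: subnormal_L_subgroup_of_def reached_by_normal_series_def)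
  \<comment> \<open>The series starts at \<open>\<mu>\<close>, so \<open>m = 0\<close> already
    reaches \<open>\<eta>\<close>, the condition on \<open>i < 0\<close> being vacuous.\<close>
  have "subnormal_defect G \<mu> \<eta> = 0" if "\<eta> = \<mu>"
    using that by (simp add: subnormal_defect_def reached_by_normal_series_def)
  then show ?thesis
    using normal_eq subnormal_eq normal_L_subgroup_of_refl[OF assms(2)]
    unfolding proper_L_subgroup_of_def by blast
qed

end
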